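(* Let $m\ge 15$ be an odd integer and put $$J=\{2n+1: 7\le n\le 14\}\ \cup\ \{k^2+5k+c: k\ge 4,\ c\in\{\pm1,\pm3,5\}\}\ \cup\ \{k^2+5k-5: k\ge 19\}$$ ($k$ ranging over integers). If $m\notin J$, then $m$ is ordinary, i.e. $\hat{l}=l_0$ where $l_0=2\lfloor\sqrt{m}-\frac{3}{2}\rfloor+1$.
   Context: For odd $m\ge 3$ let $\mathbb{Z}_m=\mathbb{Z}/m\mathbb{Z}$. A Cayley subset of $\mathbb{Z}_m$ is a subset $S$ with $0\notin S$, $S=-S$, generating $\mathbb{Z}_m$. $X(S)$ is the Cayley graph on $\mathbb{Z}_m$ ($x\sim y$ iff $y-x\in S$), with non-trivial eigenvalues $\mu_j(S)=\sum_{a\in S}e^{2\pi i a j/m}$ ($1\le j\le m-1$) and $\mu(S)=\max_j|\mu_j(S)|$; it is Ramanujan if $\mu(S)\le 2\sqrt{|S|-1}$. The covalency is $l(S)=m-|S|$. $\hat{l}$ is the largest covalency value $l$ such that $X(S)$ is Ramanujan for every Cayley subset $S$ with $l(S)\le l$. *)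

theory Defs
  imports Complex_Main "HOL-Algebra.Elementary_Groups"
begin

text \<open>
  The group \<open>\<int>/m\<close> is \<^const>\<open>integer_mod_group\<close> \<open>m\<close>: its carrier is \<open>{0..<int m}\<close> and
  its multiplicatively written operation is addition modulo \<open>m\<close>, so the inverse below is
  negation modulo \<open>m\<close>.
\<close>

definition cayley_subset :: "nat \<Rightarrow> int set \<Rightarrow> bool" where
  "cayley_subset m S \<longleftrightarrow>
     S \<subseteq> carrier (integer_mod_group m) \<and>
     \<one>\<^bsub>integer_mod_group m\<^esub> \<notin> S \<and>
     m_inv (integer_mod_group m) ` S = S \<and>
     generate (integer_mod_group m) S = carrier (integer_mod_group m)"

definition cayley_adj :: "nat \<Rightarrow> int set \<Rightarrow> int \<Rightarrow> int \<Rightarrow> bool" where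
  "cayley_adj m S x y \<longleftrightarrow>
     x \<in> carrier (integer_mod_group m) \<and> y \<in> carrier (integer_mod_group m) \<and>
     y \<otimes>\<^bsub>integer_mod_group m\<^esub> inv\<^bsub>integer_mod_group m\<^esub> x \<in> S"

definition cayley_eigenvalue :: "nat \<Rightarrow> int set \<Rightarrow> nat \<Rightarrow> complex" where
  "cayley_eigenvalue m S j =
     (\<Sum>a\<in>S. exp (2 * of_real pi * \<i> * of_int a * of_nat j / of_nat m))"

definition cayley_mu :: "nat \<Rightarrow> int set \<Rightarrow> real" where
  "cayley_mu m S = Max ((\<lambda>j. cmod (cayley_eigenvalue m S j)) ` {1..m - 1})"

definition ramanujan :: "nat \<Rightarrow> int set \<Rightarrow> bool" where
  "ramanujan m S \<longleftrightarrow> cayley_mu m S \<le> 2 * sqrt (real (card S) - 1)"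

definition covalency :: "nat \<Rightarrow> int set \<Rightarrow> nat" where
  "covalency m S = m - card S"

definition l_hat :: "nat \<Rightarrow> nat" where
  "l_hat m = Max {l \<in> covalency m ` {S. cayley_subset m S}.
                    \<forall>S. cayley_subset m S \<and> covalency m S \<le> l \<longrightarrow> ramanujan m S}"

definition l_zero :: "nat \<Rightarrow> int" where
  "l_zero m = 2 * \<lfloor>sqrt (real m) - 3 / 2\<rfloor> + 1"

definition ordinary :: "nat \<Rightarrow> bool" where
  "ordinary m \<longleftrightarrow> int (l_hat m) = l_zero m"

text \<open>
  The exponential sums are indeed the eigenvalues of the Cayley graph: each character of
  \<open>\<int>/m\<close> is an eigenvector of its adjacency operator.
\<close>

lemma cayley_eigenvector:
  assumes "0 < m" and S: "S \<subseteq> carrier (integer_mod_group m)"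
    and x: "x \<in> carrier (integer_mod_group m)"
  defines "\<chi> \<equiv> \<lambda>j y. exp (2 * of_real pi * \<i> * of_int y * of_nat j / of_nat m) :: complex"
  shows "(\<Sum>y | cayley_adj m S x y. \<chi> j y) = cayley_eigenvalue m S j * \<chi> j x"
proof -
  have c: "carrier (integer_mod_group m) = {0..<int m}"
    using assms(1) by (simp add: carrier_integer_mod_group)
  have per: "\<chi> j (z mod int m) = \<chi> j z" for z
  proof -
    have "of_int z = (of_int (z mod int m) + of_int (z div int m) * of_nat m :: complex)"
      by (metis mod_div_mult_eq of_int_add of_int_mult of_int_of_nat_eq)
    then have "2 * of_real pi * \<i> * of_int z * of_nat j / of_nat m =
        (2 * of_real pi * \<i> * of_int (z mod int m) * of_nat j / of_nat m +
         \<i> * of_int (z div int m * int j) * (of_real pi * 2) :: complex)"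
      using assms(1) by (simp add: field_simps)
    moreover have "exp (\<i> * of_int (z div int m * int j) * (of_real pi * 2)) = (1 :: complex)"
    proof -
      have "exp (\<i> * of_int (z div int m * int j) * (of_real pi * 2)) =
          cis (2 * pi * of_int (z div int m * int j))"
        by (simp add: cis_conv_exp mult_ac)
      then show ?thesis by (simp only: cis_multiple_2pi Ints_of_int)
    qed
    ultimately show ?thesis by (simp add: \<chi>_def exp_add)
  qed
  have mod_eq: "(y + (- x) mod int m) mod int m = (y - x) mod int m" for y
    by (simp add: mod_add_right_eq)
  have "(\<Sum>y | cayley_adj m S x y. \<chi> j y) = (\<Sum>a\<in>S. \<chi> j ((x + a) mod int m))"
  proof (rule sum.reindex_bij_witness[where i = "\<lambda>a. (x + a) mod int m"
        and j = "\<lambda>y. (y - x) mod int m"])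
    fix y assume "y \<in> {y. cayley_adj m S x y}"
    then have y: "y \<in> {0..<int m}" "(y - x) mod int m \<in> S"
      using x mod_eq by (auto simp: cayley_adj_def c)
    show "(x + (y - x) mod int m) mod int m = y" using y(1) by (simp add: mod_add_right_eq)
    show "(y - x) mod int m \<in> S" by (fact y(2))
    show "\<chi> j ((x + (y - x) mod int m) mod int m) = \<chi> j y"
      using y(1) by (simp add: mod_add_right_eq)
  next
    fix a assume a: "a \<in> S"
    then have ac: "a \<in> {0..<int m}" using S c by auto
    show e: "((x + a) mod int m - x) mod int m = a" using ac by (simp add: mod_diff_left_eq)
    show "(x + a) mod int m \<in> {y. cayley_adj m S x y}"
      using x a e assms(1) mod_eq by (auto simp: cayley_adj_def c)
  qed
  also have "\<dots> = (\<Sum>a\<in>S. \<chi> j a * \<chi> j x)"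
    unfolding per by (simp add: \<chi>_def exp_add[symmetric] add_divide_distrib[symmetric] algebra_simps)
  finally show ?thesis by (simp add: cayley_eigenvalue_def \<chi>_def sum_distrib_right)
qed

end

theory Submission
  imports Defs "HOL-Analysis.Complex_Transcendental"
begin

text \<open>
  The non-trivial characters sum to zero over \<open>\<int>/m\<close>, so the eigenvalues of \<open>S\<close> are minus the
  exponential sums over the complement \<open>T\<close> of \<open>S\<close>, which contains \<open>0\<close> and has \<open>l\<close> elements.
  The trivial bound \<open>l \<le> 2 * sqrt (m - l - 1)\<close> amounts to \<open>(l + 2)\<^sup>2 \<le> 4 * m\<close>, which gives
  \<open>l_hat \<ge> l_zero\<close>.

  Conversely let \<open>l = l_zero + 2 = 2 * r + 3\<close> and take for \<open>T\<close> the arc \<open>{-(r+1)..r+1}\<close>. By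
  \<open>cos x \<ge> 1 - x\<^sup>2 / 2\<close> the first eigenvalue has modulus at least
  \<open>l * (1 - pi\<^sup>2 * (l\<^sup>2 - 1) / (6 * m\<^sup>2))\<close>. With \<open>m = r\<^sup>2 + 5 * r + c\<close>, comparing squares asks
  asymptotically for \<open>25 - 4 * c > 16 * pi\<^sup>2 / 3 = 52.6...\<close>, that is \<open>c \<le> -7\<close>; for small \<open>r\<close> the
  lower order terms also admit \<open>c = -5\<close>. The case \<open>r = 18\<close>, \<open>c = -5\<close>, \<open>m = 409\<close> is so tight that
  it needs the quartic term of the cosine. All values \<open>c > -5\<close> are removed by \<open>J\<close>. As \<open>m\<close> is odd,
  all covalencies are odd, so none lies strictly between \<open>l_zero\<close> and \<open>l\<close>.
\<close>

section \<open>Non-trivial eigenvalues via the complement\<close>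

lemma cayley_eigenvalue_carrier:
  assumes "1 \<le> j" "j \<le> m - 1"
  shows "cayley_eigenvalue m {0..<int m} j = 0"
proof -
  define w where "w = exp (2 * of_real pi * \<i> * of_nat j / of_nat m :: complex)"
  have m: "m > 1" "0 < j" "j < m" using assms by auto
  have "w \<noteq> 1"
    unfolding w_def
  proof
    assume "exp (2 * of_real pi * \<i> * of_nat j / of_nat m :: complex) = 1"
    then obtain n :: int where "2 * pi * real j / real m = of_int (2 * n) * pi"
      using m by (auto simp: exp_eq_1)
    then have "real_of_int (int j) = real_of_int (n * int m)"
      using m by (simp add: field_simps)
    then have "int j = n * int m" by (simp only: of_int_eq_iff)
    then have "m dvd j" by (metis dvd_triv_right int_dvd_int_iff)
    then show False using m by (simp add: nat_dvd_not_less)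
  qed
  have "w ^ m = exp (2 * of_real pi * \<i> * of_nat j)"
    using m by (simp add: w_def exp_of_nat_mult[symmetric])
  also have "\<dots> = 1" by (auto simp: exp_eq_1 intro: exI[of _ "int j"])
  finally have "w ^ m = 1" .
  have "cayley_eigenvalue m {0..<int m} j = (\<Sum>a<m. w ^ a)"
    unfolding cayley_eigenvalue_def
    by (rule sum.reindex_bij_witness[where i = int and j = nat])
       (auto simp: w_def exp_of_nat_mult[symmetric] algebra_simps)
  also have "\<dots> = 0"
    using geometric_sum[OF \<open>w \<noteq> 1\<close>, of m] \<open>w ^ m = 1\<close> by simp
  finally show ?thesis .
qed

lemma cayley_eigenvalue_complement:
  assumes "S \<subseteq> {0..<int m}" "1 \<le> j" "j \<le> m - 1"
  shows "cayley_eigenvalue m S j = - cayley_eigenvalue m ({0..<int m} - S) j"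
  using sum.subset_diff[OF assms(1), of "\<lambda>a. exp (2 * of_real pi * \<i> * of_int a * of_nat j / of_nat m) :: complex"]
    cayley_eigenvalue_carrier[OF assms(2,3)]
  by (simp add: cayley_eigenvalue_def eq_neg_iff_add_eq_0 add.commute)

lemma cmod_cayley_eigenvalue_le: "cmod (cayley_eigenvalue m T j) \<le> real (card T)"
proof -
  have "cmod (cayley_eigenvalue m T j) \<le> (\<Sum>a\<in>T. 1)"
    unfolding cayley_eigenvalue_def by (rule sum_norm_le) (simp add: norm_exp_eq_Re)
  then show ?thesis by simp
qed

lemma Re_cayley_eigenvalue:
  "Re (cayley_eigenvalue m T j) = (\<Sum>a\<in>T. cos (2 * pi * of_int a * of_nat j / of_nat m))"
  unfolding cayley_eigenvalue_def by (simp add: Re_exp)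

section \<open>Covalency, parity and the arcs\<close>

lemma cayley_subset_imp_subset:
  assumes "cayley_subset m S" "0 < m" shows "S \<subseteq> {0..<int m}"
  using assms by (simp add: cayley_subset_def carrier_integer_mod_group)

lemma card_complement_eq_covalency:
  assumes "S \<subseteq> {0..<int m}"
  shows "card ({0..<int m} - S) = covalency m S"
  using assms by (simp add: covalency_def card_Diff_subset finite_subset[OF assms])

text \<open>Negation has no fixed point on \<open>S\<close>, since \<open>0\<close> is excluded and
  \<open>m\<close> is odd; it swaps the residues below \<open>m / 2\<close> with those
  above.\<close>

lemma even_card_cayley_subset:
  assumes "cayley_subset m S" "odd m"
  shows "even (card S)"
proof -
  have m: "0 < m" using assms(2) by (auto intro: Nat.gr0I)
  note sub = cayley_subset_imp_subset[OF assms(1) m]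
  have zero: "0 \<notin> S" using assms(1) by (simp add: cayley_subset_def)
  have neg: "int m - a \<in> S" if "a \<in> S" for a
  proof -
    have "a \<in> {0..<int m}" "a \<noteq> 0" using that sub zero by auto
    moreover have "m_inv (integer_mod_group m) a \<in> S"
      using that assms(1) by (auto simp: cayley_subset_def)
    ultimately show ?thesis
      using m by (simp add: carrier_integer_mod_group zmod_zminus1_eq_if)
  qed
  define L where "L = {a \<in> S. 2 * a < int m}"
  define U where "U = {a \<in> S. int m < 2 * a}"
  have "finite S" using sub finite_subset by blast
  then have fin: "finite L" "finite U" by (auto simp: L_def U_def)
  have "a \<in> L \<union> U" if "a \<in> S" for a
    using that \<open>odd m\<close> by (cases "2 * a" "int m" rule: linorder_cases)
      (auto simp: L_def U_def, metis even_of_nat dvd_triv_left)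
  then have "S = L \<union> U" by (auto simp: L_def U_def)
  moreover have "L \<inter> U = {}" by (auto simp: L_def U_def)
  moreover have "bij_betw (\<lambda>a. int m - a) L U"
    by (rule bij_betwI[where g = "\<lambda>a. int m - a"]) (auto simp: L_def U_def neg)
  ultimately show ?thesis using fin by (simp add: card_Un_disjoint bij_betw_same_card)
qed

text \<open>The set is the complement of the arc \<open>-n..n\<close>. The bound on \<open>m\<close>
  places the consecutive residues \<open>n + 1\<close> and \<open>n + 2\<close> in it, and their
  difference \<open>1\<close> generates the group.\<close>

lemma cayley_subset_arc:
  assumes "2 * n + 3 \<le> m"
  shows "cayley_subset m {int n + 1..int m - int n - 1}"
proof -
  let ?S = "{int n + 1..int m - int n - 1}" and ?G = "integer_mod_group m"
  have C: "carrier ?G = {0..<int m}" using assms by (simp add: carrier_integer_mod_group)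
  have inv: "m_inv ?G a = int m - a" if "a \<in> ?S" for a
    using that assms C by (simp add: zmod_zminus1_eq_if)
  have "m_inv ?G ` ?S = (\<lambda>a. int m - a) ` ?S" using inv by (rule image_cong[OF refl])
  also have "\<dots> = ?S" by auto
  finally have sym: "m_inv ?G ` ?S = ?S" .
  have incl: "int n + 1 \<in> ?S" "int n + 2 \<in> ?S" using assms by auto
  have "(int n + 2) \<otimes>\<^bsub>?G\<^esub> m_inv ?G (int n + 1) \<in> generate ?G ?S"
    using incl by (intro generate.eng generate.incl generate.inv)
  moreover have "(int n + 2) \<otimes>\<^bsub>?G\<^esub> m_inv ?G (int n + 1) = 1"
    unfolding inv[OF incl(1)] using assms by simp
  ultimately have one: "1 \<in> generate ?G ?S" by metis
  have "int k \<in> generate ?G ?S" if "k < m" for k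
    using that
  proof (induction k)
    case 0
    then show ?case using generate.one[of ?G ?S] by simp
  next
    case (Suc k)
    then have "int k \<otimes>\<^bsub>?G\<^esub> 1 \<in> generate ?G ?S" by (intro generate.eng one) simp
    then show ?case using Suc.prems by (simp add: add.commute)
  qed
  then have "{0..<int m} \<subseteq> generate ?G ?S"
    by (metis atLeastLessThan_iff nat_0_le nat_less_iff subsetI)
  moreover have sub: "?S \<subseteq> carrier ?G" unfolding C by auto
  moreover have "generate ?G ?S \<subseteq> carrier ?G"
    by (rule group.generate_incl[OF group_integer_mod_group sub])
  ultimately have "generate ?G ?S = carrier ?G" unfolding C by (intro equalityI)
  then show ?thesis
    using sym sub by (simp add: cayley_subset_def)
qed

lemma covalency_arc:
  assumes "2 * n + 1 \<le> m"
  shows "covalency m {int n + 1..int m - int n - 1} = 2 * n + 1"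
  using assms by (simp add: covalency_def)

section \<open>Upper and lower bounds for \<open>cayley_mu\<close>\<close>

lemma ramanujan_if_covalency_le:
  assumes S: "cayley_subset m S" and m: "1 < m"
    and cov: "(covalency m S + 2)\<^sup>2 \<le> 4 * m"
  shows "ramanujan m S"
proof -
  have sub: "S \<subseteq> {0..<int m}" using cayley_subset_imp_subset[OF S] m by simp
  have le: "card S \<le> m" using card_mono[OF _ sub] by simp
  let ?l = "covalency m S"
  have "(real ?l + 2)\<^sup>2 \<le> 4 * real m"
    using of_nat_mono[OF cov, where ?'a = real] by (simp add: add.commute)
  moreover have "real (card S) = real m - real ?l"
    using le by (simp add: covalency_def)
  ultimately have "(real ?l / 2)\<^sup>2 \<le> real (card S) - 1"
    by (simp add: power2_eq_square field_simps)
  then have l: "real ?l \<le> 2 * sqrt (real (card S) - 1)"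
    using real_le_rsqrt by fastforce
  have "cmod (cayley_eigenvalue m S j) \<le> real ?l" if "j \<in> {1..m - 1}" for j
    using that cmod_cayley_eigenvalue_le[of m "{0..<int m} - S" j]
    by (simp add: cayley_eigenvalue_complement[OF sub] card_complement_eq_covalency[OF sub])
  then have "cayley_mu m S \<le> real ?l"
    unfolding cayley_mu_def using m by (subst Max_le_iff) auto
  then show ?thesis using l by (simp add: ramanujan_def)
qed

lemma cayley_mu_arc_ge:
  assumes "2 * n + 3 \<le> m"
  shows "1 + 2 * (\<Sum>t=1..n. cos (2 * pi * real t / real m))
    \<le> cayley_mu m {int n + 1..int m - int n - 1}"
proof -
  let ?S = "{int n + 1..int m - int n - 1}" and ?c = "\<lambda>a::int. cos (2 * pi * of_int a / of_nat m)"
  have sub: "?S \<subseteq> {0..<int m}" by auto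
  \<comment> \<open>The block ending in \<open>m - 1\<close> represents \<open>-n..-1\<close>;
    reflection identifies its cosine sum with that over \<open>1..n\<close>.\<close>
  have T: "{0..<int m} - ?S = insert 0 ({1..int n} \<union> {int m - int n..int m - 1})"
    using assms by auto
  have 1: "sum ?c {1..int n} = (\<Sum>t=1..n. cos (2 * pi * real t / real m))"
    by (rule sum.reindex_bij_witness[where i = int and j = nat]) auto
  have 2: "sum ?c {int m - int n..int m - 1} = sum ?c {1..int n}"
  proof (rule sum.reindex_bij_witness[where i = "\<lambda>a. int m - a" and j = "\<lambda>a. int m - a"])
    fix a
    have "2 * pi * of_int (int m - a) / of_nat m = 2 * pi - 2 * pi * of_int a / of_nat m"
      using assms by (simp add: field_simps)
    then show "?c (int m - a) = ?c a" by (simp add: cos_diff)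
  qed auto
  have "Re (cayley_eigenvalue m ({0..<int m} - ?S) 1) = sum ?c ({0..<int m} - ?S)"
    by (simp add: Re_cayley_eigenvalue)
  also have "\<dots> = 1 + (sum ?c {1..int n} + sum ?c {int m - int n..int m - 1})"
    unfolding T using assms by (subst sum.insert) (auto simp: sum.union_disjoint)
  also have "\<dots> = 1 + 2 * (\<Sum>t=1..n. cos (2 * pi * real t / real m))"
    unfolding 1 2 by simp
  finally have "1 + 2 * (\<Sum>t=1..n. cos (2 * pi * real t / real m))
      \<le> cmod (cayley_eigenvalue m ({0..<int m} - ?S) 1)"
    using complex_Re_le_cmod by metis
  also have "\<dots> = cmod (cayley_eigenvalue m ?S 1)"
    using assms by (simp add: cayley_eigenvalue_complement[OF sub])
  also have "\<dots> \<le> cayley_mu m ?S"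
    unfolding cayley_mu_def using assms by (intro Max_ge) auto
  finally show ?thesis .
qed

section \<open>Lower bounds for cosine sums\<close>

lemma cos_ge_quadratic: "1 - x\<^sup>2 / 2 \<le> cos x" for x :: real
proof -
  have "(sin (x / 2))\<^sup>2 \<le> (x / 2)\<^sup>2"
    using abs_sin_x_le_abs_x[of "x / 2"] by (simp add: abs_le_square_iff[symmetric])
  then show ?thesis using cos_double_sin[of "x / 2"] by (simp add: power2_eq_square)
qed

text \<open>For \<open>\<bar>x\<bar> \<le> 1\<close> the sextic remainder costs at most
  \<open>x ^ 4 / 720\<close>, and 1/24 - 1/720 > 1/25.\<close>

lemma cos_ge_quartic:
  fixes x :: real
  assumes "\<bar>x\<bar> \<le> 1"
  shows "1 - x\<^sup>2 / 2 + x ^ 4 / 25 \<le> cos x"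
proof -
  obtain t where "cos x = (\<Sum>k<6. cos_coeff k * x ^ k) + cos (t + 1 / 2 * real 6 * pi) / fact 6 * x ^ 6"
    using Maclaurin_cos_expansion[of x 6] by blast
  moreover have "(-1) / fact 6 * x ^ 6 \<le> cos (t + 1 / 2 * real 6 * pi) / fact 6 * x ^ 6"
    by (intro mult_right_mono divide_right_mono) auto
  moreover have "{..<6} = {0, 1, 2, 3, 4, 5 :: nat}" by auto
  then have "(\<Sum>k<6. cos_coeff k * x ^ k) = 1 - x\<^sup>2 / 2 + x ^ 4 / 24"
    by (simp add: cos_coeff_def fact_numeral)
  ultimately have "1 - x\<^sup>2 / 2 + x ^ 4 / 24 - x ^ 6 / 720 \<le> cos x"
    by (simp add: fact_numeral)
  moreover have "x ^ 4 * x\<^sup>2 \<le> x ^ 4 * 1"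
    using assms by (intro mult_left_mono) (auto simp: abs_square_le_1)
  then have "x ^ 6 \<le> x ^ 4" by (simp flip: power_add)
  moreover have "0 \<le> x ^ 4" by simp
  ultimately show ?thesis by linarith
qed

text \<open>Sum \<open>cos_ge_quadratic\<close> termwise; the closed form comes from the sum of
  squares n(n+1)(2n+1)/6.\<close>

lemma sum_cos_ge_quadratic:
  assumes "0 < m"
  shows "real (2 * n + 1) * (1 - 2 * pi\<^sup>2 * real (n * (n + 1)) / (3 * (real m)\<^sup>2))
    \<le> 1 + 2 * (\<Sum>t=1..n. cos (2 * pi * real t / real m))"
proof (induction n)
  case (Suc n)
  have "1 - (2 * pi * real (Suc n) / real m)\<^sup>2 / 2 \<le> cos (2 * pi * real (Suc n) / real m)"
    by (rule cos_ge_quadratic)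
  moreover have "real (2 * Suc n + 1) * (1 - 2 * pi\<^sup>2 * real (Suc n * (Suc n + 1)) / (3 * (real m)\<^sup>2)) =
     real (2 * n + 1) * (1 - 2 * pi\<^sup>2 * real (n * (n + 1)) / (3 * (real m)\<^sup>2)) +
     2 * (1 - (2 * pi * real (Suc n) / real m)\<^sup>2 / 2)"
    using assms by (simp add: field_simps power2_eq_square)
  ultimately show ?case using Suc by simp
qed simp

lemma pi_squared_bounds: "9.869 \<le> pi\<^sup>2" "pi\<^sup>2 \<le> 9.87"
proof -
  have "(3.14159::real)\<^sup>2 \<le> pi\<^sup>2" using pi_approx(1) by (intro power_mono) auto
  then show "9.869 \<le> pi\<^sup>2" by (simp add: power2_eq_square)
  have "pi\<^sup>2 \<le> (3.1416::real)\<^sup>2" using pi_approx(2) by (intro power_mono) auto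
  then show "pi\<^sup>2 \<le> 9.87" by (simp add: power2_eq_square)
qed


section \<open>Arcs violating the Ramanujan bound\<close>

lemma not_ramanujan_arc:
  assumes "2 * n + 3 \<le> m" and "0 \<le> B"
    and "B \<le> 1 + 2 * (\<Sum>t=1..n. cos (2 * pi * real t / real m))"
    and "4 * (real m - 2 * real n - 2) < B\<^sup>2"
  shows "\<not> ramanujan m {int n + 1..int m - int n - 1}"
proof -
  let ?S = "{int n + 1..int m - int n - 1}"
  have c: "real (card ?S) - 1 = real m - 2 * real n - 2" using assms(1) by (simp add: of_nat_diff)
  have "real m - 2 * real n - 2 < (B / 2)\<^sup>2" using assms(4) by (simp add: power_divide)
  then have "sqrt (real (card ?S) - 1) < B / 2"
    unfolding c using \<open>0 \<le> B\<close> by (intro real_less_lsqrt) auto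
  then have "2 * sqrt (real (card ?S) - 1) < cayley_mu m ?S"
    using assms(3) cayley_mu_arc_ge[OF assms(1)] by linarith
  then show ?thesis by (simp add: ramanujan_def)
qed

text \<open>\<open>A\<close> is the relative loss in \<open>sum_cos_ge_quadratic\<close> with
  \<open>pi\<^sup>2\<close> rounded up to 9.87, so 6.58 = 2 * 9.87 / 3. The condition
  \<open>A \<le> 1\<close> keeps the bound non-negative.\<close>

lemma not_ramanujan_arc_quadratic:
  fixes n m :: nat
  defines "A \<equiv> 6.58 * (real n * (real n + 1)) / (real m)\<^sup>2"
  assumes "2 * n + 3 \<le> m" and "A \<le> 1"
    and "4 * (real m - 2 * real n - 2) < ((2 * real n + 1) * (1 - A))\<^sup>2"
  shows "\<not> ramanujan m {int n + 1..int m - int n - 1}"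
proof (rule not_ramanujan_arc[OF assms(2) _ _ assms(4)])
  show "0 \<le> (2 * real n + 1) * (1 - A)" using \<open>A \<le> 1\<close> by simp
  have "2 * pi\<^sup>2 * real (n * (n + 1)) / (3 * (real m)\<^sup>2)
      \<le> 2 * 9.87 * real (n * (n + 1)) / (3 * (real m)\<^sup>2)"
    using pi_squared_bounds(2) by (intro divide_right_mono mult_right_mono) auto
  also have "\<dots> = A"
    using assms(2) by (simp add: A_def divide_simps) (simp add: algebra_simps)
  finally have "(2 * real n + 1) * (1 - A)
      \<le> real (2 * n + 1) * (1 - 2 * pi\<^sup>2 * real (n * (n + 1)) / (3 * (real m)\<^sup>2))"
    by (intro mult_mono) (use \<open>A \<le> 1\<close> in auto)
  also have "\<dots> \<le> 1 + 2 * (\<Sum>t=1..n. cos (2 * pi * real t / real m))"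
    using assms(2) by (intro sum_cos_ge_quadratic) simp
  finally show "(2 * real n + 1) * (1 - A) \<le> 1 + 2 * (\<Sum>t=1..n. cos (2 * pi * real t / real m))" .
qed

text \<open>This is the criterion of \<open>not_ramanujan_arc_quadratic\<close> for
  \<open>n = r + 1\<close>, with \<open>(1 - A)\<^sup>2\<close> weakened to \<open>1 - 2 * A\<close>
  and denominators cleared; 13.16 = 2 * 6.58.\<close>

lemma arc_polynomial_inequality:
  fixes r m :: real
  assumes r: "5 \<le> r" and lo: "r\<^sup>2 + 3 * r + 3 \<le> m" and hi: "m \<le> r\<^sup>2 + 5 * r - 7"
  shows "13.16 * (2 * r + 3)\<^sup>2 * ((r + 1) * (r + 2)) < ((2 * r + 5)\<^sup>2 - 4 * m) * m\<^sup>2"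
proof -
  define M where "M = r\<^sup>2 + 5 * r - 7"
  define d where "d = M - m"
  \<comment> \<open>In the shifted variable all coefficients of the difference are positive. The
    leading one is 53 - 4 * 13.16 = 0.36, where 53 is
    \<open>(2 * r + 5)\<^sup>2 - 4 * M\<close>.\<close>
  define t where "t = r - 5"
  have t: "0 \<le> t" "r = t + 5" using r by (auto simp: t_def)
  have d: "0 \<le> d" "d \<le> 2 * r - 10" "m = M - d" using lo hi by (auto simp: d_def M_def)
  have "53 * M\<^sup>2 - 13.16 * (2 * r + 3)\<^sup>2 * ((r + 1) * (r + 2)) =
      0.36 * t ^ 4 + 221.36 * t ^ 3 + 3151.92 * t ^ 2 + 10716.04 * t + 4587.32"
    unfolding t(2) M_def by (simp add: power2_eq_square power3_eq_cube power4_eq_xxxx field_simps)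
  also have "\<dots> > 0" using t(1) by (intro add_nonneg_pos add_nonneg_nonneg) auto
  finally have 1: "13.16 * (2 * r + 3)\<^sup>2 * ((r + 1) * (r + 2)) < 53 * M\<^sup>2" by simp
  have M: "0 < M" "0 \<le> M - 26.5 - 2 * d"
    using d(2) r mult_mono[OF r r] by (auto simp: M_def power2_eq_square)
  \<comment> \<open>The left-hand side below is \<open>53 * M\<^sup>2\<close> at the upper end \<open>m = M\<close> of the range, the worst case.\<close>
  have "((2 * r + 5)\<^sup>2 - 4 * m) * m\<^sup>2 = (53 + 4 * d) * (M - d)\<^sup>2"
    unfolding d(3) by (simp add: M_def power2_eq_square algebra_simps)
  also have "\<dots> = 53 * M\<^sup>2 + 4 * d * M * (M - 26.5 - 2 * d) + (53 + 4 * d) * d\<^sup>2"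
    by (simp add: power2_eq_square algebra_simps)
  also have "\<dots> \<ge> 53 * M\<^sup>2" using M d(1) by simp
  finally show ?thesis using 1 by linarith
qed

lemma not_ramanujan_arc_generic:
  fixes r m :: nat
  assumes r: "5 \<le> r" and lo: "r\<^sup>2 + 3 * r + 3 \<le> m" and hi: "m + 7 \<le> r\<^sup>2 + 5 * r"
  shows "\<not> ramanujan m {int (r + 1) + 1..int m - int (r + 1) - 1}"
proof (rule not_ramanujan_arc_quadratic)
  let ?r = "real r" and ?m = "real m"
  let ?A = "6.58 * (real (r + 1) * (real (r + 1) + 1)) / ?m\<^sup>2"
  have R: "5 \<le> ?r" "?r\<^sup>2 + 3 * ?r + 3 \<le> ?m" "?m \<le> ?r\<^sup>2 + 5 * ?r - 7"
    using r of_nat_mono[OF lo, where ?'a = real] of_nat_mono[OF hi, where ?'a = real] by auto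
  have m7: "7 \<le> ?m" using r lo by simp
  have m: "(?r + 1) * (?r + 2) \<le> ?m" using R(2) by (simp add: power2_eq_square algebra_simps)
  have "6.58 * ((?r + 1) * (?r + 2)) \<le> ?m * ?m" using m m7 by (intro mult_mono) auto
  then show "?A \<le> 1" using m7 by (simp add: power2_eq_square algebra_simps)
  show "2 * (r + 1) + 3 \<le> m" using lo r by simp
  have "13.16 * (2 * ?r + 3)\<^sup>2 * ((?r + 1) * (?r + 2)) / ?m\<^sup>2 < (2 * ?r + 5)\<^sup>2 - 4 * ?m"
    using arc_polynomial_inequality[OF R] m7 by (simp add: pos_divide_less_eq)
  also have "(2 * ?r + 5)\<^sup>2 - 4 * ?m = (2 * ?r + 3)\<^sup>2 - 4 * (?m - 2 * real (r + 1) - 2)"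
    by (simp add: power2_eq_square algebra_simps)
  also have "13.16 * (2 * ?r + 3)\<^sup>2 * ((?r + 1) * (?r + 2)) / ?m\<^sup>2 = 2 * ?A * (2 * ?r + 3)\<^sup>2"
    using m7 by (simp add: divide_simps) (simp add: algebra_simps)
  finally have "4 * (?m - 2 * real (r + 1) - 2) < (2 * ?r + 3)\<^sup>2 - 2 * ?A * (2 * ?r + 3)\<^sup>2"
    by (simp only: less_diff_eq add.commute diff_less_eq)
  also have "\<dots> \<le> ((2 * ?r + 3) * (1 - ?A))\<^sup>2"
  proof -
    \<comment> \<open>Dropping the square of \<open>L * A\<close> makes the condition linear in
      \<open>A\<close>.\<close>
    have "L\<^sup>2 - 2 * A * L\<^sup>2 \<le> (L * (1 - A))\<^sup>2" for L A :: real
      using zero_le_power2[of "L * A"] by (simp add: power2_eq_square algebra_simps)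
    then show ?thesis .
  qed
  also have "2 * ?r + 3 = 2 * real (r + 1) + 1" by simp
  finally show "4 * (?m - 2 * real (r + 1) - 2) < ((2 * real (r + 1) + 1) * (1 - ?A))\<^sup>2" .
qed

text \<open>Here 19.74 = 2 * 9.87 bounds \<open>2 * pi\<^sup>2\<close> from above, and 62.3 bounds
  \<open>16 / 25 * pi ^ 4\<close> from below.\<close>

lemma not_ramanujan_arc_409: "\<not> ramanujan 409 {int 19 + 1..int 409 - int 19 - 1}"
proof (rule not_ramanujan_arc)
  let ?B = "1 + 2 * (\<Sum>t=1..19. 1 - 19.74 * (real t / 409)\<^sup>2 + 62.3 * (real t / 409) ^ 4)"
  have "1 - 19.74 * (real t / 409)\<^sup>2 + 62.3 * (real t / 409) ^ 4 \<le> cos (2 * pi * real t / 409)"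
    if "t \<in> {1..19}" for t
  proof -
    let ?x = "2 * pi * real t / 409"
    have "pi * real t \<le> 4 * 19" using that pi_less_4 by (intro mult_mono) auto
    then have "\<bar>?x\<bar> \<le> 1" by (simp add: abs_mult)
    then have "1 - ?x\<^sup>2 / 2 + ?x ^ 4 / 25 \<le> cos ?x" by (rule cos_ge_quartic)
    moreover have "?x\<^sup>2 / 2 = 2 * pi\<^sup>2 * (real t / 409)\<^sup>2"
      by (simp add: power2_eq_square)
    moreover have "?x ^ 4 / 25 = 16 / 25 * (pi\<^sup>2)\<^sup>2 * (real t / 409) ^ 4"
      by (simp add: power2_eq_square power4_eq_xxxx)
    moreover have "2 * pi\<^sup>2 * (real t / 409)\<^sup>2 \<le> 19.74 * (real t / 409)\<^sup>2"
      using pi_squared_bounds(2) by (intro mult_right_mono) auto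
    moreover have "(9.869::real)\<^sup>2 \<le> (pi\<^sup>2)\<^sup>2"
      by (rule power_mono[OF pi_squared_bounds(1)]) simp
    then have "62.3 * (real t / 409) ^ 4 \<le> 16 / 25 * (pi\<^sup>2)\<^sup>2 * (real t / 409) ^ 4"
      by (intro mult_right_mono) (auto simp: power2_eq_square)
    ultimately show ?thesis by linarith
  qed
  then show "?B \<le> 1 + 2 * (\<Sum>t=1..19. cos (2 * pi * real t / real 409))"
    by (simp only: of_nat_numeral) (intro add_left_mono mult_left_mono sum_mono; simp)
  \<comment> \<open>2470 and 562666 are the sums of the squares and of the fourth powers of
    1..19.\<close>
  have B: "?B = 39 - 4 * 9.87 * 2470 / 409\<^sup>2 + 124.6 * 562666 / 409 ^ 4"
    by (simp add: eval_nat_numeral)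
  show "0 \<le> ?B" unfolding B by simp
  show "4 * (real 409 - 2 * real 19 - 2) < ?B\<^sup>2" unfolding B by (simp add: power2_eq_square)
qed simp

text \<open>Now \<open>(2 * r + 5)\<^sup>2 - 4 * m\<close> is only 45, too small for a uniform
  argument. For \<open>r\<close> up to 17 the quadratic bound is checked numerically, value by
  value.\<close>

lemma not_ramanujan_arc_minus_five:
  assumes "4 \<le> r" "r \<le> 18" "m + 5 = r\<^sup>2 + 5 * r"
  shows "\<not> ramanujan m {int (r + 1) + 1..int m - int (r + 1) - 1}"
proof (cases "r = 18")
  case True
  then show ?thesis using not_ramanujan_arc_409 assms(3) by simp
next
  case False
  have m: "m = r\<^sup>2 + 5 * r - 5" using assms(3) by simp
  have "r \<in> {4, 5, 6, 7, 8, 9, 10, 11, 12, 13, 14, 15, 16, 17}"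
    using assms(1,2) False by simp presburger
  then show ?thesis
    unfolding m by (intro not_ramanujan_arc_quadratic) (auto simp: power2_eq_square)
qed


section \<open>Evaluation of \<open>l_hat\<close> outside \<open>J\<close>\<close>

theorem theorem3p6:
  fixes m :: nat and J :: "int set"
  assumes "m \<ge> 15" and "odd m"
    and "J = {2 * n + 1 | n. 7 \<le> n \<and> n \<le> 14}
           \<union> {k\<^sup>2 + 5 * k + c | k c. 4 \<le> k \<and> c \<in> {1, -1, 3, -3, 5}}
           \<union> {k\<^sup>2 + 5 * k - 5 | k. 19 \<le> k}"
    and "int m \<notin> J"
  shows "ordinary m"
proof -
  \<comment> \<open>The first part of \<open>J\<close> consists of the odd numbers from 15 to
    29.\<close>
  have m31: "31 \<le> m"
  proof (rule ccontr)
    assume "\<not> 31 \<le> m"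
    moreover obtain n where "m = 2 * n + 1" using \<open>odd m\<close> oddE by blast
    ultimately have "int m = 2 * int n + 1 \<and> 7 \<le> int n \<and> int n \<le> 14" using \<open>15 \<le> m\<close> by auto
    then have "int m \<in> J" unfolding assms(3) by blast
    then show False using assms(4) by simp
  qed
  define r where "r = nat \<lfloor>sqrt (real m) - 3 / 2\<rfloor>"
  have "5.5 \<le> sqrt (real m)" using m31 by (intro real_le_rsqrt) (simp add: power2_eq_square)
  then have r4: "4 \<le> r" and floor: "\<lfloor>sqrt (real m) - 3 / 2\<rfloor> = int r"
    by (auto simp: r_def le_nat_iff le_floor_iff)
  then have "real r + 3 / 2 \<le> sqrt (real m)" "sqrt (real m) < real r + 5 / 2"
    by (auto simp: floor_eq_iff)
  then have "(real r + 3 / 2)\<^sup>2 \<le> real m" "real m < (real r + 5 / 2)\<^sup>2"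
    using power_mono[of "real r + 3 / 2" "sqrt (real m)" 2]
      power_strict_mono[of "sqrt (real m)" "real r + 5 / 2" 2] by simp_all
  \<comment> \<open>The squares end in 9/4 and 25/4; integrality of \<open>m\<close> then sharpens
    the bounds to the offsets 3 and 6.\<close>
  then have "real (r\<^sup>2 + 3 * r + 2) < real m" "real m < real (r\<^sup>2 + 5 * r + 7)"
    by (simp_all add: power2_eq_square field_simps)
  then have lo: "r\<^sup>2 + 3 * r + 3 \<le> m" and hi: "m \<le> r\<^sup>2 + 5 * r + 6"
    by linarith+
  have small: "2 * (r + 1) + 3 \<le> m" using lo r4 by simp
  have not_ram: "\<not> ramanujan m {int (r + 1) + 1..int m - int (r + 1) - 1}"
  proof -
    define c where "c = int m - ((int r)\<^sup>2 + 5 * int r)"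
    have mc: "int m = (int r)\<^sup>2 + 5 * int r + c" by (simp add: c_def)
    \<comment> \<open>\<open>r\<^sup>2 + 5 * r\<close> is a product of \<open>r\<close> and
      \<open>r + 5\<close>, hence even.\<close>
    have "odd c" using \<open>odd m\<close> by (simp add: c_def)
    have "c \<notin> {1, -1, 3, -3, 5}" using assms(4) r4 mc unfolding assms(3) by fastforce
    moreover have "c \<le> 6" using hi by (simp add: c_def flip: of_nat_power)
    ultimately have "c = -5 \<or> c \<le> -7" using \<open>odd c\<close> by simp presburger
    then consider "c = -5" | "c \<le> -7" by blast
    then show ?thesis
    proof cases
      case 1
      have "r \<le> 18"
      proof (rule ccontr)
        assume "\<not> r \<le> 18"
        then have "19 \<le> int r \<and> int m = (int r)\<^sup>2 + 5 * int r - 5" using mc 1 by simp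
        then have "int m \<in> J" unfolding assms(3) by blast
        then show False using assms(4) by simp
      qed
      moreover have "int (m + 5) = int (r\<^sup>2 + 5 * r)" using mc 1 by simp
      then have "m + 5 = r\<^sup>2 + 5 * r" by (simp only: of_nat_eq_iff)
      ultimately show ?thesis using r4 by (intro not_ramanujan_arc_minus_five)
    next
      case 2
      then have "int (m + 7) \<le> int (r\<^sup>2 + 5 * r)" using mc by simp
      then have h: "m + 7 \<le> r\<^sup>2 + 5 * r" by (simp only: of_nat_le_iff)
      \<comment> \<open>For \<open>r = 4\<close> the two bounds would read \<open>31 \<le> m\<close>
        and \<open>m \<le> 29\<close>.\<close>
      then have "r \<noteq> 4" using lo by auto
      then show ?thesis using r4 lo h by (intro not_ramanujan_arc_generic) auto
    qed
  qed
  let ?L = "{l \<in> covalency m ` {S. cayley_subset m S}.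
    \<forall>S. cayley_subset m S \<and> covalency m S \<le> l \<longrightarrow> ramanujan m S}"
  have "Max ?L = 2 * r + 1"
  proof (rule Max_eqI)
    have "?L \<subseteq> {..m}" by (auto simp: covalency_def)
    then show "finite ?L" using finite_subset by blast
    have "ramanujan m S" if "cayley_subset m S" "covalency m S \<le> 2 * r + 1" for S
    proof (rule ramanujan_if_covalency_le[OF that(1)])
      have "(covalency m S + 2)\<^sup>2 \<le> (2 * r + 3)\<^sup>2" using that(2) by (intro power_mono) auto
      also have "\<dots> \<le> 4 * m" using lo by (simp add: power2_eq_square algebra_simps)
      finally show "(covalency m S + 2)\<^sup>2 \<le> 4 * m" .
    qed (use m31 in simp)
    \<comment> \<open>\<open>l_hat\<close> ranges over attained covalencies only; the arc complement
      with \<open>n = r\<close> realizes this one.\<close>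
    moreover have "2 * r + 1 \<in> covalency m ` {S. cayley_subset m S}"
      using covalency_arc[of r m] cayley_subset_arc[of r m] small
      by (intro image_eqI[where x = "{int r + 1..int m - int r - 1}"]) auto
    ultimately show "2 * r + 1 \<in> ?L" by auto
  next
    fix l assume l: "l \<in> ?L"
    then obtain S where S: "cayley_subset m S" "l = covalency m S" by auto
    have "S \<subseteq> {0..<int m}" using cayley_subset_imp_subset[OF S(1)] m31 by simp
    then have "card S \<le> m" using card_mono[of "{0..<int m}" S] by simp
    then have "odd l"
      using even_card_cayley_subset[OF S(1) \<open>odd m\<close>] \<open>odd m\<close> S(2) by (simp add: covalency_def)
    \<comment> \<open>Otherwise membership in \<open>?L\<close> would make the arc complement of
      covalency \<open>2 * r + 3\<close> Ramanujan, against \<open>not_ram\<close>. Oddness then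
      excludes \<open>2 * r + 2\<close>.\<close>
    have "\<not> 2 * (r + 1) + 1 \<le> l"
      using l not_ram cayley_subset_arc[OF small] covalency_arc[of "r + 1" m] small by auto
    then show "l \<le> 2 * r + 1" using \<open>odd l\<close> by presburger
  qed
  then show ?thesis by (simp add: ordinary_def l_hat_def l_zero_def floor)
qed

end
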